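(* Let $Q_\infty=(q_0,q_1,q_2,\dots)$ be an infinite stochastic vector with positive coordinates and fix a GLS-expansion with cylinder lengths given by $Q_\infty$. Let $(\xi_k)_{k\ge1}$ be independent identically distributed random variables with $P(\xi_k=i)=p_i\ge 0$, $\sum_{i\ge 0}p_i=1$, let $\xi=\Delta^{\mathit{GLS}}_{\xi_1\xi_2\dots\xi_k\dots}$, and let $S_\xi$ be the spectrum of the distribution of $\xi$. Let $V:=\{i:p_i>0\}=\{i_1,i_2,\dots\}$. Suppose the set $\Delta^{\mathit{GLS}}_\infty$ is at most countable. Then: (1) if the equation $\sum_{i\in V}q_i^x=1$ has one root $\alpha_0$ on $[0,1]$, then $\dim_H S_\xi=\alpha_0$; (2) if the equation $\sum_{i\in V}q_i^x=1$ has no roots on $[0,1]$, then $\dim_H S_\xi=\lim_{k\to\infty}\alpha_k$, where $\alpha_k$ is the root of the equation $\sum_{i\in V_k}q_i^x=1$ with $V_k=\{i_1,i_2,\dots,i_k\}\subset V$.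
   Context: GLS-expansion: Let $Q_\infty=(q_0,q_1,\dots)$ be a stochastic vector with positive coordinates ($q_i>0$, $\sum_{i\ge 0} q_i=1$). Choose closed intervals $\Delta_i=[a_i,b_i]\subset[0,1]$, $i\in\mathbb{N}_0=\{0,1,2,\dots\}$, with pairwise disjoint interiors and $|\Delta_i|=q_i$ (cylinders of rank 1). Let $f_i:[0,1]\to\Delta_i$ be the increasing affine bijection. The cylinders of rank $n$ are $\Delta_{i_1i_2\dots i_n}=f_{i_1}\circ\dots\circ f_{i_n}([0,1])$, so the placement of $\Delta_{i_1\dots i_n}$ inside $\Delta_{i_1\dots i_{n-1}}$ is the same as that of $\Delta_{i_n}$ inside $[0,1]$ and $|\Delta_{i_1\dots i_n}|=q_{i_1}\cdots q_{i_n}$. For any sequence $(i_k)$ in $\mathbb{N}_0$, $\bigcap_k \Delta_{i_1\dots i_k}$ is a single point, denoted $\Delta^{\mathit{GLS}}_{i_1i_2\dots}$. $\Delta^{\mathit{GLS}}_\infty$ denotes the set of points of $[0,1]$ not belonging to any cylinder of rank 1, i.e. $[0,1]\setminus\bigcup_i\Delta_i$. The spectrum $S_\xi$ of the distribution of $\xi$ is its support: the minimal closed set $S$ with $P(\xi\in S)=1$. *)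

theory Defs
  imports "HOL-Probability.Probability"
begin

text \<open>GLS-expansion: cylinder of rank 1 number i is [a i, a i + q i]; f i is the increasing
affine bijection of [0,1] onto it.\<close>

definition gls_f :: "(nat \<Rightarrow> real) \<Rightarrow> (nat \<Rightarrow> real) \<Rightarrow> nat \<Rightarrow> real \<Rightarrow> real" where
  "gls_f a q i x = a i + q i * x"

fun gls_map :: "(nat \<Rightarrow> real) \<Rightarrow> (nat \<Rightarrow> real) \<Rightarrow> nat list \<Rightarrow> real \<Rightarrow> real" where
  "gls_map a q [] = id"
| "gls_map a q (i # is) = gls_f a q i \<circ> gls_map a q is"

definition gls_cyl :: "(nat \<Rightarrow> real) \<Rightarrow> (nat \<Rightarrow> real) \<Rightarrow> nat list \<Rightarrow> real set" where
  "gls_cyl a q is = gls_map a q is ` {0..1}"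

definition gls_point :: "(nat \<Rightarrow> real) \<Rightarrow> (nat \<Rightarrow> real) \<Rightarrow> (nat \<Rightarrow> nat) \<Rightarrow> real" where
  "gls_point a q d = (THE x. \<forall>n. x \<in> gls_cyl a q (map d [0..<n]))"

definition gls_infty :: "(nat \<Rightarrow> real) \<Rightarrow> (nat \<Rightarrow> real) \<Rightarrow> real set" where
  "gls_infty a q = {0..1} - (\<Union>i. {a i .. a i + q i})"

definition gls_expansion :: "(nat \<Rightarrow> real) \<Rightarrow> (nat \<Rightarrow> real) \<Rightarrow> bool" where
  "gls_expansion a q \<longleftrightarrow>
     (\<forall>i. q i > 0) \<and> q sums 1 \<and>
     (\<forall>i. 0 \<le> a i \<and> a i + q i \<le> 1) \<and>
     (\<forall>i j. i \<noteq> j \<longrightarrow> {a i <..< a i + q i} \<inter> {a j <..< a j + q j} = {})"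

definition spectrum_of :: "'a measure \<Rightarrow> ('a \<Rightarrow> real) \<Rightarrow> real set" where
  "spectrum_of M f = \<Inter> {S. closed S \<and> {\<omega> \<in> space M. f \<omega> \<in> S} \<in> sets M \<and>
                                 measure M {\<omega> \<in> space M. f \<omega> \<in> S} = 1}"

text \<open>Hausdorff measure and dimension on the real line (convention diam(B)^0 = 1 for nonempty B).\<close>
definition hd_term :: "real \<Rightarrow> real set \<Rightarrow> ennreal" where
  "hd_term s B = ennreal (if B = {} then 0 else if s = 0 then 1 else diameter B powr s)"

definition hausdorff_content :: "real \<Rightarrow> real \<Rightarrow> real set \<Rightarrow> ennreal" where
  "hausdorff_content s \<delta> A =
     (INF C \<in> {C :: nat \<Rightarrow> real set. A \<subseteq> (\<Union>n. C n) \<and> (\<forall>n. bounded (C n) \<and> diameter (C n) \<le> \<delta>)}.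
        (\<Sum>n. hd_term s (C n)))"

definition hausdorff_measure :: "real \<Rightarrow> real set \<Rightarrow> ennreal" where
  "hausdorff_measure s A = (SUP \<delta> \<in> {0<..}. hausdorff_content s \<delta> A)"

definition hausdorff_dim :: "real set \<Rightarrow> real" where
  "hausdorff_dim A = Inf {s. s \<ge> 0 \<and> hausdorff_measure s A = 0}"

end

theory Submission
  imports Defs
begin

text \<open>
The spectrum is the closure \<open>S\<close> of the set of points all of whose digits lie in
\<open>V = {i. p i > 0}\<close>. Apart from countably many points, \<open>S\<close> is covered by its
images under the maps \<open>f i\<close> with \<open>i \<in> V\<close>; iterating this, the cylinders of rank
\<open>n\<close> with digits in \<open>V\<close> have total \<open>s\<close>-weight \<open>(\<Sum>i\<in>V. q i powr s) ^ n\<close>, which tends to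
\<open>0\<close> as soon as the sum is below \<open>1\<close>. Conversely, if a finite \<open>F \<subseteq> V\<close> has
\<open>(\<Sum>i\<in>F. q i powr s) > 1\<close>, then at some rank the sum over the words in \<open>F\<close> exceeds \<open>2\<close>,
and taking every other cylinder leaves a finite system with positive gaps whose sum is at least
\<open>1\<close>. For such a separated system every finite cover of \<open>S\<close> has \<open>s\<close>-weight bounded below.
\<close>

section \<open>Finite covers of separated self-similar systems\<close>

text \<open>With a common bound \<open>r < 1\<close> on many numbers, raising the exponent shrinks
  every power by at least the same factor \<open>r powr (t - s)\<close>. Sums of powers at two
  exponents can then be compared whatever the number of terms.\<close>

lemma powr_le_powr_diff_mult:
  fixes x y s t :: real
  assumes "0 < x" "x \<le> r" "s \<le> t"
  shows "x powr t \<le> r powr (t - s) * x powr s"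
proof -
  have "x powr t = x powr (t - s) * x powr s"
    by (simp add: powr_add[symmetric])
  also have "\<dots> \<le> r powr (t - s) * x powr s"
    using assms by (intro mult_right_mono powr_mono2) auto
  finally show ?thesis .
qed

text \<open>Sets shorter than the gap \<open>\<epsilon>\<close> meet at most one of the copies of \<open>S\<close>, so a cover
splits into covers of the copies, each with fewer members; rescaling and induction on the size
of the cover replace the usual mass distribution.\<close>

lemma separated_cover_sum_ge:
  fixes c \<rho> :: "'j \<Rightarrow> real" and l :: "'i \<Rightarrow> real"
  assumes S: "S \<noteq> {}" and J: "finite J" "card J \<ge> 2"
    and \<rho>: "\<And>j. j \<in> J \<Longrightarrow> \<rho> j > 0"
    and inv: "\<And>j x. j \<in> J \<Longrightarrow> x \<in> S \<Longrightarrow> c j + \<rho> j * x \<in> S"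
    and sep: "\<And>j k x y. j \<in> J \<Longrightarrow> k \<in> J \<Longrightarrow> j \<noteq> k \<Longrightarrow> x \<in> S \<Longrightarrow> y \<in> S
                \<Longrightarrow> \<bar>(c j + \<rho> j * x) - (c k + \<rho> k * y)\<bar> \<ge> \<epsilon>"
    and sum: "(\<Sum>j\<in>J. \<rho> j powr s) \<ge> 1" and "\<epsilon> > 0" "s > 0"
    and cover: "finite I" "S \<subseteq> (\<Union>i\<in>I. U i)"
    and len: "\<And>i x y. i \<in> I \<Longrightarrow> x \<in> U i \<Longrightarrow> y \<in> U i \<Longrightarrow> \<bar>x - y\<bar> \<le> l i"
    and l0: "\<And>i. i \<in> I \<Longrightarrow> l i \<ge> 0"
  shows "(\<Sum>i\<in>I. l i powr s) \<ge> \<epsilon> powr s"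
  using cover len l0
\<comment> \<open>\<open>U\<close> and \<open>l\<close> stay general because the induction
  hypothesis is applied to the preimages of the \<open>U i\<close> under one map, with lengths
  divided by its ratio.\<close>
proof (induction "card I" arbitrary: I U l rule: less_induct)
  case less
  show ?case
  proof (cases "\<exists>i\<in>I. l i \<ge> \<epsilon>")
    case True
    then obtain i where i: "i \<in> I" "l i \<ge> \<epsilon>" by blast
    have "\<epsilon> powr s \<le> l i powr s" using i \<open>\<epsilon> > 0\<close> \<open>s > 0\<close> by (intro powr_mono2) auto
    also have "\<dots> \<le> (\<Sum>i\<in>I. l i powr s)"
      using i less.prems by (intro member_le_sum) auto
    finally show ?thesis .
  next
    case False
    define g where "g = (\<lambda>j x. c j + \<rho> j * x)"
    define K where "K = (\<lambda>j. {i\<in>I. U i \<inter> g j ` S \<noteq> {}})"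
    have Ksub: "K j \<subseteq> I" for j by (auto simp: K_def)
    have finK: "finite (K j)" for j using Ksub less.prems(1) finite_subset by blast
    have disj: "K j \<inter> K k = {}" if "j \<in> J" "k \<in> J" "j \<noteq> k" for j k
    proof (rule ccontr)
      assume "K j \<inter> K k \<noteq> {}"
      then obtain i x y where "i \<in> I" "x \<in> S" "y \<in> S" "g j x \<in> U i" "g k y \<in> U i"
        unfolding K_def by blast
      then have "\<bar>g j x - g k y\<bar> \<le> l i" "\<bar>g j x - g k y\<bar> \<ge> \<epsilon>"
        using less.prems(3) sep that by (auto simp: g_def)
      then show False using False \<open>i \<in> I\<close> by force
    qed
    have cov: "\<exists>i\<in>K j. g j x \<in> U i" if "j \<in> J" "x \<in> S" for j x
      using that inv[of j x] less.prems(2) by (fastforce simp: g_def K_def)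
    have Kne: "K j \<noteq> {}" if "j \<in> J" for j
      using S cov[OF that] by blast
    \<comment> \<open>A second index \<open>k\<close> exists since \<open>card J \<ge> 2\<close>,
      and the nonempty \<open>K k\<close> is missing from \<open>K j\<close>.\<close>
    have smaller: "card (K j) < card I" if "j \<in> J" for j
    proof -
      have "\<not> J \<subseteq> {j}" using J card_mono[of "{j}" J] by auto
      then obtain k where "k \<in> J" "k \<noteq> j" by auto
      then have "K j \<subset> I" using disj[of j k] Kne[of k] Ksub that by blast
      then show ?thesis using less.prems(1) psubset_card_mono by blast
    qed
    have step: "\<rho> j powr s * \<epsilon> powr s \<le> (\<Sum>i\<in>K j. l i powr s)" if j: "j \<in> J" for j
    proof -
      have "\<epsilon> powr s \<le> (\<Sum>i\<in>K j. (l i / \<rho> j) powr s)"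
      proof (rule less.hyps[OF smaller[OF j] finK, where U = "\<lambda>i. {x. g j x \<in> U i}"])
        show "S \<subseteq> (\<Union>i\<in>K j. {x. g j x \<in> U i})" using cov j by blast
        show "0 \<le> l i / \<rho> j" if "i \<in> K j" for i
          using that Ksub less.prems(4) \<rho>[OF j] by (force intro: divide_nonneg_pos)
        fix i x y assume "i \<in> K j" "x \<in> {x. g j x \<in> U i}" "y \<in> {x. g j x \<in> U i}"
        then have "\<bar>g j x - g j y\<bar> \<le> l i" using less.prems(3) Ksub by blast
        moreover have "\<bar>g j x - g j y\<bar> = \<rho> j * \<bar>x - y\<bar>"
          using \<rho>[OF j] by (simp add: g_def abs_mult flip: right_diff_distrib)
        ultimately show "\<bar>x - y\<bar> \<le> l i / \<rho> j"
          using \<rho>[OF j] by (simp add: field_simps)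
      qed
      also have "\<dots> = (\<Sum>i\<in>K j. l i powr s) / \<rho> j powr s"
        using \<rho>[OF j] Ksub less.prems(4)
        by (subst sum_divide_distrib) (intro sum.cong refl powr_divide; force)
      finally show ?thesis using \<rho>[OF j] by (simp add: field_simps)
    qed
    have "\<epsilon> powr s \<le> (\<Sum>j\<in>J. \<rho> j powr s) * \<epsilon> powr s"
      using sum by (simp add: mult_le_cancel_right1)
    also have "\<dots> \<le> (\<Sum>j\<in>J. \<Sum>i\<in>K j. l i powr s)"
      unfolding sum_distrib_right by (intro sum_mono step)
    also have "\<dots> = (\<Sum>i\<in>(\<Union>j\<in>J. K j). l i powr s)"
      using J finK disj by (subst sum.UNION_disjoint) auto
    also have "\<dots> \<le> (\<Sum>i\<in>I. l i powr s)"
      using less.prems(1) Ksub by (intro sum_mono2) auto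
    finally show ?thesis .
  qed
qed

text \<open>Of the intervals in their order on the line, either those of even rank or those of odd rank
carry half of the weight, and a whole interval lies between any two of them.\<close>

lemma separated_subfamily:
  fixes c \<rho> :: "'j \<Rightarrow> real" and h :: "'j \<Rightarrow> real"
  assumes "finite W" and \<rho>: "\<And>j. j \<in> W \<Longrightarrow> \<rho> j \<ge> \<epsilon>" and "\<epsilon> > 0"
    and disj: "\<And>j k. j \<in> W \<Longrightarrow> k \<in> W \<Longrightarrow> j \<noteq> k \<Longrightarrow> c j + \<rho> j \<le> c k \<or> c k + \<rho> k \<le> c j"
    and h: "(\<Sum>j\<in>W. h j) \<ge> 2"
  obtains J where "J \<subseteq> W" "(\<Sum>j\<in>J. h j) \<ge> 1"
    "\<And>j k. j \<in> J \<Longrightarrow> k \<in> J \<Longrightarrow> j \<noteq> k \<Longrightarrow> c j + \<rho> j + \<epsilon> \<le> c k \<or> c k + \<rho> k + \<epsilon> \<le> c j"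
proof -
  define rk where "rk = (\<lambda>j. card {k\<in>W. c k < c j})"
  have step: "c j + \<rho> j + \<epsilon> \<le> c k"
    if "j \<in> W" "k \<in> W" "c j < c k" "even (rk j) = even (rk k)" for j k
  proof -
    have sub: "insert j {i\<in>W. c i < c j} \<subseteq> {i\<in>W. c i < c k}" using that by auto
    \<comment> \<open>Equality would mean \<open>rk k = Suc (rk j)\<close>, against equal parity. So
      a third interval lies between the two, and its length, at least \<open>\<epsilon>\<close>, is
      the gap.\<close>
    have "insert j {i\<in>W. c i < c j} \<noteq> {i\<in>W. c i < c k}"
    proof
      assume "insert j {i\<in>W. c i < c j} = {i\<in>W. c i < c k}"
      then have "rk k = card (insert j {i\<in>W. c i < c j})" by (simp add: rk_def)
      also have "\<dots> = Suc (rk j)" using \<open>finite W\<close> by (simp add: rk_def)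
      finally show False using that by simp
    qed
    then obtain i where i: "i \<in> W" "c i < c k" "i \<noteq> j" "\<not> c i < c j"
      using sub by auto
    have "c j + \<rho> j \<le> c i" using disj[of j i] i \<rho>[of i] that \<open>\<epsilon> > 0\<close> by fastforce
    moreover have "c i + \<rho> i \<le> c k" using disj[of i k] i \<rho>[of k] that \<open>\<epsilon> > 0\<close> by fastforce
    ultimately show ?thesis using \<rho>[of i] i by linarith
  qed
  have sep: "c j + \<rho> j + \<epsilon> \<le> c k \<or> c k + \<rho> k + \<epsilon> \<le> c j"
    if "j \<in> W" "k \<in> W" "j \<noteq> k" "even (rk j) = even (rk k)" for j k
  proof -
    have "c j \<noteq> c k" using disj[of j k] that \<rho>[of j] \<rho>[of k] \<open>\<epsilon> > 0\<close> by auto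
    then show ?thesis using step[of j k] step[of k j] that by fastforce
  qed
  have "(\<Sum>j\<in>W. h j) = (\<Sum>j\<in>{j\<in>W. even (rk j)}. h j) + (\<Sum>j\<in>{j\<in>W. odd (rk j)}. h j)"
    using \<open>finite W\<close> by (subst sum.union_disjoint[symmetric]) (auto intro!: sum.cong)
  then consider "(\<Sum>j\<in>{j\<in>W. even (rk j)}. h j) \<ge> 1" | "(\<Sum>j\<in>{j\<in>W. odd (rk j)}. h j) \<ge> 1"
    using h by linarith
  then show ?thesis
  proof cases
    case 1
    show ?thesis by (rule that[OF _ 1]) (use sep in auto)
  next
    case 2
    show ?thesis by (rule that[OF _ 2]) (use sep in auto)
  qed
qed

section \<open>Criteria for positive and for zero Hausdorff measure\<close>

lemma hd_term_pos: "s > 0 \<Longrightarrow> hd_term s B = ennreal (diameter B powr s)"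
  by (simp add: hd_term_def)

text \<open>Makes a cover open at arbitrarily small cost, ready for compactness. A small
  \<open>e\<close>-neighbourhood works: distances grow by at most \<open>2 * e\<close>, and
  \<open>(D + 2 * e) powr s\<close> tends to \<open>D powr s\<close>.\<close>

lemma bounded_diameter_open_superset:
  fixes B :: "real set"
  assumes "bounded B" "s > 0" "\<eta> > 0"
  obtains U l where "open U" "B \<subseteq> U" "\<And>x y. x \<in> U \<Longrightarrow> y \<in> U \<Longrightarrow> \<bar>x - y\<bar> \<le> l" "l \<ge> 0"
    "l powr s \<le> diameter B powr s + \<eta>"
proof (cases "B = {}")
  case True
  show ?thesis by (rule that[of "{}" 0]) (use True assms in auto)
next
  case False
  define D where "D = diameter B"
  have "D \<ge> 0" using assms by (simp add: D_def diameter_ge_0)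
  \<comment> \<open>\<open>D\<close> may be 0, so the limit is one-sided and rests on a nonnegative
    base and a positive exponent.\<close>
  have "((\<lambda>e. (D + 2 * e) powr s) \<longlongrightarrow> (D + 2 * 0) powr s) (at_right 0)"
    using \<open>D \<ge> 0\<close> \<open>s > 0\<close>
    by (intro tendsto_powr2 tendsto_intros) (auto simp: eventually_at_right_less eventually_at intro!: exI[of _ 1])
  then have "\<forall>\<^sub>F e in at_right 0. (D + 2 * e) powr s < D powr s + \<eta>"
    using \<open>\<eta> > 0\<close> by (intro order_tendstoD(2)[where y = "(D + 2 * 0) powr s"]) auto
  moreover have "\<forall>\<^sub>F e in at_right (0::real). e > 0" by (simp add: eventually_at_right_less)
  ultimately obtain e where e: "e > 0" "(D + 2 * e) powr s < D powr s + \<eta>"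
    by (metis (mono_tags, lifting) eventually_conj eventually_happens trivial_limit_at_right_real)
  show ?thesis
  proof (rule that[of "\<Union>b\<in>B. ball b e" "D + 2 * e"])
    fix x y assume "x \<in> (\<Union>b\<in>B. ball b e)" "y \<in> (\<Union>b\<in>B. ball b e)"
    then obtain b b' where b: "b \<in> B" "b' \<in> B" "dist b x < e" "dist b' y < e" by auto
    then have "dist b b' \<le> D" using assms by (simp add: D_def diameter_bounded_bound)
    then show "\<bar>x - y\<bar> \<le> D + 2 * e" using b by (simp add: dist_real_def)
  qed (use e \<open>D \<ge> 0\<close> in \<open>auto simp: D_def\<close>)
qed

text \<open>At \<open>s = 0\<close> every nonempty set costs 1 whatever its diameter, so one
  nonempty member of the cover is enough.\<close>

lemma hausdorff_measure_nonzero_0: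
  assumes "S \<noteq> {}"
  shows "hausdorff_measure 0 S \<noteq> 0"
proof -
  have "1 \<le> hausdorff_content 0 1 S"
    unfolding hausdorff_content_def
  proof (rule INF_greatest)
    fix C :: "nat \<Rightarrow> real set"
    assume "C \<in> {C. S \<subseteq> (\<Union>n. C n) \<and> (\<forall>n. bounded (C n) \<and> diameter (C n) \<le> 1)}"
    then obtain n where "C n \<noteq> {}" using assms by blast
    then have "1 = (\<Sum>i\<in>{n}. hd_term 0 (C i))" by (simp add: hd_term_def)
    also have "\<dots> \<le> (\<Sum>i. hd_term 0 (C i))" by (rule sum_le_suminf) auto
    finally show "1 \<le> (\<Sum>i. hd_term 0 (C i))" .
  qed
  also have "\<dots> \<le> hausdorff_measure 0 S"
    unfolding hausdorff_measure_def by (rule SUP_upper) auto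
  finally show ?thesis by auto
qed

text \<open>Reduces countable covers to finite ones: each member is enlarged to an open set at a
  summable extra cost, then compactness applies.\<close>

lemma hausdorff_measure_nonzero_compact:
  assumes "compact S" "s > 0" "e > 0"
    and fin: "\<And>(I :: nat set) U l. finite I \<Longrightarrow> S \<subseteq> (\<Union>i\<in>I. U i) \<Longrightarrow>
      (\<And>i x y. i \<in> I \<Longrightarrow> x \<in> U i \<Longrightarrow> y \<in> U i \<Longrightarrow> \<bar>x - y\<bar> \<le> l i) \<Longrightarrow>
      (\<And>i. i \<in> I \<Longrightarrow> l i \<ge> (0::real)) \<Longrightarrow> e \<le> (\<Sum>i\<in>I. l i powr s)"
  shows "hausdorff_measure s S \<noteq> 0"
proof -
  \<comment> \<open>The measure is a supremum over scales, so scale 1 suffices. Half of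
    \<open>e\<close> pays for the enlargements, since the \<open>\<eta> n\<close> sum to
    \<open>e / 2\<close>.\<close>
  have "ennreal (e / 2) \<le> hausdorff_content s 1 S"
    unfolding hausdorff_content_def
  proof (rule INF_greatest)
    fix C :: "nat \<Rightarrow> real set"
    assume C: "C \<in> {C. S \<subseteq> (\<Union>n. C n) \<and> (\<forall>n. bounded (C n) \<and> diameter (C n) \<le> 1)}"
    define \<eta> where "\<eta> = (\<lambda>n. e / 2 * (1 / 2) ^ Suc n)"
    have "\<exists>U l. open U \<and> C n \<subseteq> U \<and> (\<forall>x\<in>U. \<forall>y\<in>U. \<bar>x - y\<bar> \<le> l) \<and> l \<ge> 0 \<and>
             l powr s \<le> diameter (C n) powr s + \<eta> n" for n
      using bounded_diameter_open_superset[of "C n" s "\<eta> n"] C assms(2,3)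
      by (metis (no_types, lifting) \<eta>_def half_gt_zero mem_Collect_eq mult_pos_pos zero_less_divide_1_iff zero_less_numeral zero_less_power)
    then obtain U l where U: "\<And>n. open (U n)" "\<And>n. C n \<subseteq> U n"
        "\<And>n x y. x \<in> U n \<Longrightarrow> y \<in> U n \<Longrightarrow> \<bar>x - y\<bar> \<le> l n" "\<And>n. l n \<ge> 0"
        "\<And>n. l n powr s \<le> diameter (C n) powr s + \<eta> n"
      by metis
    have "S \<subseteq> (\<Union>n\<in>UNIV. U n)" using C U(2) by blast
    then obtain I where I: "finite I" "S \<subseteq> (\<Union>n\<in>I. U n)"
      using compactE_image[OF \<open>compact S\<close>, of UNIV U] U(1) by metis
    have "e \<le> (\<Sum>i\<in>I. l i powr s)" using fin[OF I] U by blast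
    also have "\<dots> \<le> (\<Sum>i\<in>I. diameter (C i) powr s + \<eta> i)" by (intro sum_mono U)
    also have "\<dots> = (\<Sum>i\<in>I. diameter (C i) powr s) + (\<Sum>i\<in>I. \<eta> i)" by (rule sum.distrib)
    also have "(\<Sum>i\<in>I. \<eta> i) \<le> e / 2"
    proof -
      have "\<eta> sums (e / 2 * 1)" unfolding \<eta>_def by (intro sums_mult power_half_series)
      moreover have "\<eta> n \<ge> 0" for n using \<open>e > 0\<close> by (simp add: \<eta>_def)
      ultimately show ?thesis using sum_le_suminf[of \<eta> I] I(1) by (simp add: sums_iff)
    qed
    finally have "e / 2 \<le> (\<Sum>i\<in>I. diameter (C i) powr s)" by simp
    then have "ennreal (e / 2) \<le> (\<Sum>i\<in>I. hd_term s (C i))"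
      using \<open>s > 0\<close> by (simp add: hd_term_pos sum_ennreal ennreal_leI)
    also have "\<dots> \<le> (\<Sum>i. hd_term s (C i))" using I(1) by (intro sum_le_suminf) auto
    finally show "ennreal (e / 2) \<le> (\<Sum>i. hd_term s (C i))" .
  qed
  also have "\<dots> \<le> hausdorff_measure s S"
    unfolding hausdorff_measure_def by (rule SUP_upper) auto
  finally show ?thesis using \<open>e > 0\<close> by (auto simp: ennreal_eq_0_iff)
qed

text \<open>\<open>sum_decode\<close> sends even numbers to \<open>Inl\<close> and odd ones to
  \<open>Inr\<close>, so summing in consecutive pairs separates the two series. It serves to merge
  two covers into one sequence.\<close>

lemma suminf_interleave_ennreal:
  fixes f g :: "nat \<Rightarrow> ennreal"
  shows "(\<Sum>n. case sum_decode n of Inl i \<Rightarrow> f i | Inr i \<Rightarrow> g i) = (\<Sum>n. f n) + (\<Sum>n. g n)"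
proof -
  define h where "h = (\<lambda>n. case sum_decode n of Inl i \<Rightarrow> f i | Inr i \<Rightarrow> g i)"
  have "(\<Sum>n. h n) = (\<Sum>n. h (2 * n) + h (2 * n + 1))"
  proof -
    have "(\<lambda>n. \<Sum>i<n. h i) \<longlonglongrightarrow> (\<Sum>n. h n)" by (simp add: summable_LIMSEQ)
    then have "(\<lambda>n. \<Sum>i<2 * n. h i) \<longlonglongrightarrow> (\<Sum>n. h n)"
      by (rule LIMSEQ_subseq_LIMSEQ[where f = "\<lambda>n. 2 * n", unfolded o_def]) (auto simp: strict_mono_def)
    moreover have "(\<Sum>i<2 * n. h i) = (\<Sum>i<n. h (2 * i) + h (2 * i + 1))" for n
      by (induction n) (auto simp: algebra_simps)
    ultimately have "(\<lambda>i. h (2 * i) + h (2 * i + 1)) sums (\<Sum>n. h n)" by (simp add: sums_def)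
    then show ?thesis by (simp add: sums_iff)
  qed
  also have "\<dots> = (\<Sum>n. f n + g n)" by (simp add: h_def sum_decode_def)
  also have "\<dots> = (\<Sum>n. f n) + (\<Sum>n. g n)" by (intro suminf_add[symmetric]) auto
  finally show ?thesis by (simp add: h_def)
qed

text \<open>A countable set joins each cover for free, because singletons have diameter 0 and
  \<open>s > 0\<close>. At any scale all late covers are fine enough to be admissible, and their
  cost tends to 0.\<close>

lemma hausdorff_measure_eq_0I:
  assumes "s > 0" "countable N" and seq: "\<And>n. S \<subseteq> N \<union> (\<Union>m. C n m)"
    and bd: "\<And>n m. bounded (C n m)" and diam: "\<And>n m. diameter (C n m) \<le> \<delta> n"
    and "\<delta> \<longlonglongrightarrow> 0" and sum: "\<And>n. (\<Sum>m. hd_term s (C n m)) \<le> t n" and "t \<longlonglongrightarrow> 0"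
  shows "hausdorff_measure s S = 0"
proof -
  define P where "P = (\<lambda>m. if N = {} then {} else {from_nat_into N m})"
  have P: "N \<subseteq> (\<Union>m. P m)"
    using assms(2) by (auto simp: P_def) (metis from_nat_into_surj)
  have P0: "bounded (P m)" "diameter (P m) = 0" for m by (auto simp: P_def)
  have "hausdorff_content s e S = 0" if "e > 0" for e
  proof -
    have le: "hausdorff_content s e S \<le> t n" if n: "\<delta> n \<le> e" for n
    proof -
      define D where "D = (\<lambda>m. case sum_decode m of Inl i \<Rightarrow> C n i | Inr i \<Rightarrow> P i)"
      have cover: "S \<subseteq> (\<Union>m. D m)"
      proof
        fix x assume "x \<in> S"
        then consider m where "x \<in> C n m" | m where "x \<in> P m" using seq[of n] P by blast
        then show "x \<in> (\<Union>m. D m)"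
        proof cases
          case 1
          then have "x \<in> D (sum_encode (Inl m))" by (simp add: D_def)
          then show ?thesis by blast
        next
          case 2
          then have "x \<in> D (sum_encode (Inr m))" by (simp add: D_def)
          then show ?thesis by blast
        qed
      qed
      have "hausdorff_content s e S \<le> (\<Sum>m. hd_term s (D m))"
        unfolding hausdorff_content_def
      proof (intro INF_lower CollectI conjI allI)
        fix m
        show "bounded (D m)" using bd P0 by (auto simp: D_def split: sum.split)
        show "diameter (D m) \<le> e"
          using diam[of n] P0 n \<open>e > 0\<close> order_trans by (fastforce simp: D_def split: sum.split)
      qed (rule cover)
      also have "\<dots> = (\<Sum>m. case sum_decode m of Inl i \<Rightarrow> hd_term s (C n i) | Inr i \<Rightarrow> hd_term s (P i))"
        by (intro suminf_cong) (simp add: D_def split: sum.split)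
      also have "\<dots> = (\<Sum>m. hd_term s (C n m)) + (\<Sum>m. hd_term s (P m))"
        by (rule suminf_interleave_ennreal)
      also have "\<dots> = (\<Sum>m. hd_term s (C n m))"
        using \<open>s > 0\<close> P0 by (simp add: hd_term_pos)
      finally show ?thesis using sum[of n] order_trans by blast
    qed
    have "\<forall>\<^sub>F n in sequentially. \<delta> n < e" using \<open>\<delta> \<longlonglongrightarrow> 0\<close> \<open>e > 0\<close> by (rule order_tendstoD)
    then have "\<forall>\<^sub>F n in sequentially. hausdorff_content s e S \<le> t n"
      by eventually_elim (simp add: le)
    then have "hausdorff_content s e S \<le> 0"
      using \<open>t \<longlonglongrightarrow> 0\<close> by (intro tendsto_lowerbound[where F = sequentially]) auto
    then show ?thesis by simp
  qed
  then have "(SUP e\<in>{0<..}. hausdorff_content s e S) = (SUP e\<in>{0::real<..}. 0)"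
    by (intro SUP_cong) auto
  then show ?thesis by (simp add: hausdorff_measure_def)
qed

lemma diameter_affine_image_le:
  fixes B :: "real set"
  assumes "k > 0" "bounded B"
  shows "diameter ((\<lambda>x. c + k * x) ` B) \<le> k * diameter B"
proof (rule diameter_le)
  show "(\<lambda>x. c + k * x) ` B \<noteq> {} \<or> 0 \<le> k * diameter B"
    using assms by (simp add: diameter_ge_0)
  fix x y assume "x \<in> (\<lambda>x. c + k * x) ` B" "y \<in> (\<lambda>x. c + k * x) ` B"
  then obtain u v where uv: "u \<in> B" "v \<in> B" "x = c + k * u" "y = c + k * v" by blast
  then have "norm (x - y) = k * dist u v"
    using assms by (simp add: dist_real_def abs_mult flip: right_diff_distrib)
  also have "\<dots> \<le> k * diameter B"
    using uv assms by (simp add: diameter_bounded_bound)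
  finally show "norm (x - y) \<le> k * diameter B" .
qed

section \<open>Cylinders and points of the GLS-expansion\<close>

locale gls =
  fixes a q :: "nat \<Rightarrow> real"
  assumes expansion: "gls_expansion a q"
begin

abbreviation f where "f \<equiv> gls_f a q"
abbreviation g where "g \<equiv> gls_map a q"
abbreviation weight where "weight w \<equiv> prod_list (map q w)"
abbreviation prefix_word :: "(nat \<Rightarrow> nat) \<Rightarrow> nat \<Rightarrow> nat list" where
  "prefix_word d n \<equiv> map d [0..<n]"

text \<open>A bound below 1 on all \<open>q i\<close> at once: \<open>i\<close> differs from 0 or
  from 1, and two different \<open>q i\<close>, \<open>q j\<close> add up to at most 1. It makes
  cylinder lengths decay geometrically.\<close>

definition r where "r = 1 - min (q 0) (q 1)"

lemma q_pos: "q i > 0"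
  and q_sums: "q sums 1"
  and a_nonneg: "0 \<le> a i"
  and aq_le_1: "a i + q i \<le> 1"
  and interiors_disjoint: "i \<noteq> j \<Longrightarrow> {a i <..< a i + q i} \<inter> {a j <..< a j + q j} = {}"
  using expansion by (auto simp: gls_expansion_def)

text \<open>If both inequalities failed, the midpoint of the overlap would lie in both
  interiors.\<close>

lemma rank1_cylinders_ordered:
  assumes "i \<noteq> j"
  shows "a i + q i \<le> a j \<or> a j + q j \<le> a i"
proof (rule ccontr)
  assume *: "\<not> ?thesis"
  define lo hi where "lo = max (a i) (a j)" and "hi = min (a i + q i) (a j + q j)"
  have "lo < hi" using * q_pos[of j] q_pos[of i] by (auto simp: lo_def hi_def)
  then have "(lo + hi) / 2 \<in> {a i <..< a i + q i} \<inter> {a j <..< a j + q j}"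
    by (auto simp: lo_def hi_def)
  then show False using interiors_disjoint[OF assms] by blast
qed

lemma sum_q_le_1: "finite F \<Longrightarrow> sum q F \<le> 1"
  using q_sums q_pos sum_le_suminf[of q F] by (auto simp: sums_iff intro: less_imp_le)

lemma q_add_le_1: "i \<noteq> j \<Longrightarrow> q i + q j \<le> 1"
  using sum_q_le_1[of "{i, j}"] by simp

lemma r_pos: "0 < r" and r_less_1: "r < 1"
  using q_add_le_1[of 0 1] q_pos[of 0] q_pos[of 1] by (auto simp: r_def)

lemma q_le_r: "q i \<le> r"
  using q_add_le_1[of i 0] q_add_le_1[of i 1] by (cases "i = 0") (auto simp: r_def)

lemma weight_pos: "weight w > 0"
  by (induction w) (auto simp: q_pos)

lemma weight_le: "weight w \<le> r ^ length w"
  by (induction w) (auto simp: q_le_r intro!: mult_mono less_imp_le[OF r_pos] less_imp_le[OF weight_pos])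

lemma map_affine: "g w x = g w 0 + weight w * x"
proof (induction w arbitrary: x)
  case (Cons i w)
  show ?case using Cons.IH[of x] by (simp add: gls_f_def algebra_simps)
qed simp

lemma map_append: "g (v @ w) x = g v (g w x)"
  by (induction v) auto

lemma f_in_01: "x \<in> {0..1} \<Longrightarrow> f i x \<in> {0..1}"
  using a_nonneg[of i] aq_le_1[of i] q_pos[of i] mult_left_le[of x "q i"]
    mult_nonneg_nonneg[of "q i" x]
  unfolding gls_f_def atLeastAtMost_iff by linarith

lemma map_in_01: "x \<in> {0..1} \<Longrightarrow> g w x \<in> {0..1}"
  by (induction w) (use f_in_01 in auto)

lemma cyl_eq: "gls_cyl a q w = {g w 0 .. g w 0 + weight w}"
proof -
  have "gls_cyl a q w = (\<lambda>x. weight w * x + g w 0) ` {0..1}"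
    unfolding gls_cyl_def by (intro image_cong refl) (subst map_affine, rule add.commute)
  then show ?thesis
    using weight_pos[of w] image_affinity_atLeastAtMost[of "weight w" "g w 0" 0 1]
    by (simp add: ac_simps)
qed

text \<open>The cylinders are nested, closed and nonempty, with lengths at most
  \<open>r ^ n\<close>, so Cantor's intersection theorem applies. This justifies the
  \<open>THE\<close> in \<open>gls_point\<close>.\<close>

lemma point_ex1: "\<exists>!x. \<forall>n. x \<in> gls_cyl a q (prefix_word d n)"
proof -
  have "gls_cyl a q (prefix_word d (Suc n)) \<subseteq> gls_cyl a q (prefix_word d n)" for n
  proof -
    have "g (prefix_word d (Suc n)) x \<in> g (prefix_word d n) ` {0..1}" if "x \<in> {0..1}" for x
      using f_in_01[OF that, of "d n"] by (auto simp: map_append)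
    then show ?thesis by (auto simp: gls_cyl_def)
  qed
  then have "decseq (\<lambda>n. gls_cyl a q (prefix_word d n))" by (rule decseq_SucI)
  moreover have "\<exists>n. \<forall>x\<in>gls_cyl a q (prefix_word d n). \<forall>y\<in>gls_cyl a q (prefix_word d n). dist x y < \<epsilon>"
    if "\<epsilon> > 0" for \<epsilon>
  proof -
    obtain n where n: "r ^ n < \<epsilon>" using real_arch_pow_inv[OF \<open>\<epsilon> > 0\<close> r_less_1] by blast
    then have "weight (prefix_word d n) < \<epsilon>" using weight_le[of "prefix_word d n"] by simp
    then show ?thesis by (intro exI[of _ n]) (auto simp: cyl_eq dist_real_def abs_le_iff abs_less_iff)
  qed
  ultimately have "\<exists>x. \<Inter> (range (\<lambda>n. gls_cyl a q (prefix_word d n))) = {x}"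
    by (intro decreasing_closed_nest_sing)
       (auto simp: cyl_eq less_imp_le[OF weight_pos] simp del: map_map dest: decseqD)
  then show ?thesis by (auto simp: set_eq_iff)
qed

lemma point_in_cyl: "gls_point a q d \<in> gls_cyl a q (prefix_word d n)"
  unfolding gls_point_def using theI'[OF point_ex1[of d]] by blast

lemma point_eqI: "(\<And>n. x \<in> gls_cyl a q (prefix_word d n)) \<Longrightarrow> gls_point a q d = x"
  unfolding gls_point_def using point_ex1[of d] by (intro the1_equality) auto

lemma point_in_01: "gls_point a q d \<in> {0..1}"
  using point_in_cyl[of d 0] by (simp add: gls_cyl_def)

lemma cyl_dist_le:
  assumes "x \<in> gls_cyl a q w" "y \<in> gls_cyl a q w"
  shows "\<bar>x - y\<bar> \<le> r ^ length w"
  using assms weight_le[of w] by (auto simp: cyl_eq)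

text \<open>By uniqueness only membership in all cylinders has to be checked, and the cylinder of a
  nonempty word is the image under \<open>f (d 0)\<close> of the cylinder of its tail. This is the
  source of the self-similarity below.\<close>

lemma point_Suc: "gls_point a q d = f (d 0) (gls_point a q (\<lambda>k. d (Suc k)))"
proof (rule point_eqI)
  fix n
  show "f (d 0) (gls_point a q (\<lambda>k. d (Suc k))) \<in> gls_cyl a q (prefix_word d n)"
  proof (cases n)
    case 0
    then show ?thesis using f_in_01[OF point_in_01] by (simp add: gls_cyl_def)
  next
    case (Suc m)
    have "prefix_word d (Suc m) = d 0 # prefix_word (\<lambda>k. d (Suc k)) m"
      by (simp add: upt_conv_Cons map_Suc_upt[symmetric] del: upt_Suc)
    then show ?thesis
      using point_in_cyl[of "\<lambda>k. d (Suc k)" m] Suc by (auto simp: gls_cyl_def)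
  qed
qed

text \<open>Prepares measurability of the random point, as a limit of functions of finitely many
  digits.\<close>

lemma point_LIMSEQ: "(\<lambda>n. g (prefix_word d n) 0) \<longlonglongrightarrow> gls_point a q d"
proof (rule LIMSEQ_I)
  fix e :: real assume "e > 0"
  then obtain N where N: "r ^ N < e" using real_arch_pow_inv r_less_1 by blast
  have "norm (g (prefix_word d n) 0 - gls_point a q d) < e" if "n \<ge> N" for n
  proof -
    have "g (prefix_word d n) 0 \<in> gls_cyl a q (prefix_word d n)" by (auto simp: gls_cyl_def)
    then have "\<bar>g (prefix_word d n) 0 - gls_point a q d\<bar> \<le> r ^ n"
      using cyl_dist_le[OF _ point_in_cyl[of d n]] by fastforce
    also have "\<dots> \<le> r ^ N" using that r_pos r_less_1 by (intro power_decreasing) auto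
    finally show ?thesis using N by simp
  qed
  then show "\<exists>N. \<forall>n\<ge>N. norm (g (prefix_word d n) 0 - gls_point a q d) < e" by blast
qed

section \<open>Limit sets of restricted digits\<close>

text \<open>For infinite \<open>V\<close> this set need not be closed, since its cylinders can
  accumulate at points outside it. The spectrum will be its closure.\<close>

definition limit_set :: "nat set \<Rightarrow> real set" where
  "limit_set V = gls_point a q ` {d. \<forall>k. d k \<in> V}"

abbreviation closed_limit_set :: "nat set \<Rightarrow> real set" where
  "closed_limit_set V \<equiv> closure (limit_set V)"

lemma limit_set_eq: "limit_set V = (\<Union>i\<in>V. f i ` limit_set V)"
proof (intro equalityI subsetI)
  fix x assume "x \<in> limit_set V"
  then obtain d where d: "\<forall>k. d k \<in> V" "x = gls_point a q d" by (auto simp: limit_set_def)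
  then show "x \<in> (\<Union>i\<in>V. f i ` limit_set V)"
    using point_Suc[of d] by (auto simp: limit_set_def intro!: bexI[of _ "d 0"] imageI)
next
  fix x assume "x \<in> (\<Union>i\<in>V. f i ` limit_set V)"
  then obtain i d where "i \<in> V" "\<forall>k. d k \<in> V" "x = f i (gls_point a q d)"
    by (auto simp: limit_set_def)
  then show "x \<in> limit_set V"
    \<comment> \<open>\<open>case_nat i d\<close> is the digit sequence \<open>d\<close> with
      \<open>i\<close> put in front.\<close>
    using point_Suc[of "case_nat i d"]
    by (auto simp: limit_set_def split: nat.split intro!: image_eqI[of _ _ "case_nat i d"])
qed

lemma closed_limit_set_subset: "closed_limit_set V \<subseteq> {0..1}"
  by (intro closure_minimal) (use point_in_01 in \<open>auto simp: limit_set_def\<close>)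

lemma compact_closed_limit_set: "compact (closed_limit_set V)"
  using closed_limit_set_subset[of V] bounded_subset[OF bounded_closed_interval[of 0 1]]
  by (simp add: compact_eq_bounded_closed)

lemma closed_limit_set_nonempty: "V \<noteq> {} \<Longrightarrow> closed_limit_set V \<noteq> {}"
  by (auto simp: limit_set_def)

lemma f_closed_limit_set:
  assumes "i \<in> V" "x \<in> closed_limit_set V"
  shows "f i x \<in> closed_limit_set V"
proof -
  have "continuous_on (closed_limit_set V) (f i)"
    unfolding gls_f_def[abs_def] by (intro continuous_intros)
  moreover have "f i ` limit_set V \<subseteq> closed_limit_set V"
    using limit_set_eq[of V] \<open>i \<in> V\<close> closure_subset[of "limit_set V"] by blast
  ultimately have "f i ` closed_limit_set V \<subseteq> closed_limit_set V"
    by (intro image_closure_subset) auto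
  then show ?thesis using assms by blast
qed

lemma map_closed_limit_set:
  assumes "set w \<subseteq> V" "x \<in> closed_limit_set V"
  shows "g w x \<in> closed_limit_set V"
  using assms by (induction w) (auto intro: f_closed_limit_set)

text \<open>Contains every point of the unit interval outside the open rank-1 cylinders, and is
  countable as soon as \<open>gls_infty a q\<close> is.\<close>

definition exceptional :: "real set" where
  "exceptional = gls_infty a q \<union> range a \<union> range (\<lambda>i. a i + q i)"

text \<open>Inside an open rank-1 cylinder only one of the sets \<open>f i ` limit_set V\<close> is visible, so
closing \<open>limit_set V\<close> adds points only at the ends of the cylinders and outside them.\<close>

lemma closed_limit_set_subset_images:
  "closed_limit_set V \<subseteq> exceptional \<union> (\<Union>i\<in>V. f i ` closed_limit_set V)"
proof
  fix x assume x: "x \<in> closed_limit_set V"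
  show "x \<in> exceptional \<union> (\<Union>i\<in>V. f i ` closed_limit_set V)"
  proof (cases "x \<in> exceptional")
    case False
    have "x \<in> {0..1}" using x closed_limit_set_subset by blast
    then obtain i where "a i \<le> x" "x \<le> a i + q i"
      using False by (auto simp: exceptional_def gls_infty_def)
    moreover have "x \<noteq> a i" "x \<noteq> a i + q i" using False by (auto simp: exceptional_def)
    ultimately have i: "a i < x" "x < a i + q i" by auto
    \<comment> \<open>Within the radius \<open>e'\<close>, points of the limit set stay in the open
      cylinder number \<open>i\<close>, so their first map is \<open>f i\<close>. That also proves
      \<open>i \<in> V\<close>.\<close>
    have near: "\<exists>z. i \<in> V \<and> z \<in> limit_set V \<and> dist (f i z) x < e" if "e > 0" for e
    proof -
      define e' where "e' = min e (min (x - a i) (a i + q i - x))"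
      have "e' > 0" using i that by (simp add: e'_def)
      then obtain y where y: "y \<in> limit_set V" "dist y x < e'"
        using x by (auto simp: closure_approachable)
      then obtain j z where z: "j \<in> V" "z \<in> limit_set V" "y = f j z"
        using limit_set_eq[of V] by blast
      have yi: "a i < y" "y < a i + q i" using y(2) by (auto simp: e'_def dist_real_def)
      have "z \<in> {0..1}" using z(2) point_in_01 by (auto simp: limit_set_def)
      then have yj: "a j \<le> y" "y \<le> a j + q j"
        using z(3) q_pos[of j] mult_left_le[of z "q j"] by (auto simp: gls_f_def)
      have "i = j"
        using rank1_cylinders_ordered[of i j] yi yj by (rule_tac ccontr) auto
      then show ?thesis using z y(2) by (auto simp: e'_def)
    qed
    define u where "u = (x - a i) / q i"
    have fu: "f i u = x" using q_pos[of i] by (simp add: u_def gls_f_def)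
    have "u \<in> closed_limit_set V"
      unfolding closure_approachable
    proof (intro allI impI)
      fix e :: real assume "e > 0"
      then obtain z where z: "z \<in> limit_set V" "dist (f i z) x < q i * e"
        using near[of "q i * e"] q_pos[of i] by auto
      have "dist (f i z) (f i u) = q i * dist z u"
        using q_pos[of i] by (simp add: gls_f_def dist_real_def abs_mult flip: right_diff_distrib)
      then show "\<exists>y\<in>limit_set V. dist y u < e"
        using z q_pos[of i] by (auto simp: fu)
    qed
    then show ?thesis using near[of 1] fu by auto
  qed simp
qed

subsection \<open>Covers by cylinders\<close>

context
  fixes V :: "nat set"
begin

text \<open>The cylinders of rank \<open>n\<close> with digits in \<open>V\<close>, listed as a
  sequence because \<open>hausdorff_content\<close> works with sequences: \<open>m\<close> codes the
  first digit and the index of the remaining word. All other indices give the empty set, which costs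
  nothing.\<close>

primrec cover :: "nat \<Rightarrow> nat \<Rightarrow> real set" where
  "cover 0 m = (if m = 0 then {0..1} else {})"
| "cover (Suc n) m = (case prod_decode m of (i, j) \<Rightarrow> if i \<in> V then f i ` cover n j else {})"

text \<open>Collects the exceptional points met in \<open>n\<close> successive splittings. Only
  countably many maps are applied, so countability is preserved.\<close>

primrec leftover :: "nat \<Rightarrow> real set" where
  "leftover 0 = {}"
| "leftover (Suc n) = exceptional \<union> (\<Union>i. f i ` leftover n)"

lemma countable_leftover: "countable (gls_infty a q) \<Longrightarrow> countable (leftover n)"
  by (induction n) (auto simp: exceptional_def)

text \<open>Iterates \<open>closed_limit_set_subset_images\<close>: a point that is not exceptional
  has a preimage in the same set, to which the induction hypothesis applies.\<close>

lemma cover_covers: "closed_limit_set V \<subseteq> leftover n \<union> (\<Union>m. cover n m)"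
proof (induction n)
  case 0
  have "{0..1} = cover 0 0" by simp
  then show ?case using closed_limit_set_subset[of V] by blast
next
  case (Suc n)
  show ?case
  proof
    fix x assume "x \<in> closed_limit_set V"
    then consider "x \<in> exceptional" | i y where "i \<in> V" "y \<in> closed_limit_set V" "x = f i y"
      using closed_limit_set_subset_images[of V] by blast
    then show "x \<in> leftover (Suc n) \<union> (\<Union>m. cover (Suc n) m)"
    proof cases
      case 2
      consider "y \<in> leftover n" | m where "y \<in> cover n m" using Suc 2(2) by blast
      then show ?thesis
      proof cases
        case 2
        then have "x \<in> cover (Suc n) (prod_encode (i, m))" using \<open>i \<in> V\<close> \<open>x = f i y\<close> by simp
        then show ?thesis by blast
      qed (use \<open>x = f i y\<close> in auto)
    qed simp
  qed
qed

lemma f_eq: "f i = (\<lambda>x. a i + q i * x)"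
  by (auto simp: gls_f_def)

lemma bounded_f_image: "bounded B \<Longrightarrow> bounded (f i ` B)"
  unfolding f_eq using bounded_translation[OF bounded_scaling[of B "q i"], of "a i"]
  by (simp add: image_image)

lemma bounded_cover: "bounded (cover n m)"
  by (induction n arbitrary: m) (auto split: prod.split intro: bounded_f_image)

lemma diameter_cover: "diameter (cover n m) \<le> r ^ n"
proof (induction n arbitrary: m)
  case 0
  show ?case by simp
next
  case (Suc n)
  have "diameter (f i ` cover n j) \<le> r ^ Suc n" for i j
  proof -
    have "diameter (f i ` cover n j) \<le> q i * diameter (cover n j)"
      unfolding f_eq by (rule diameter_affine_image_le[OF q_pos bounded_cover])
    also have "\<dots> \<le> r * r ^ n"
      using Suc[of j] q_le_r[of i] q_pos[of i] r_pos bounded_cover[of n j]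
      by (intro mult_mono) (auto simp: diameter_ge_0)
    finally show ?thesis by simp
  qed
  then show ?case using r_pos by (auto split: prod.split)
qed

lemma hd_term_f_image:
  assumes "bounded B" "s > 0"
  shows "hd_term s (f i ` B) \<le> ennreal (q i powr s) * hd_term s B"
proof -
  have "diameter (f i ` B) powr s \<le> (q i * diameter B) powr s"
    unfolding f_eq using assms bounded_f_image[OF assms(1), of i]
    by (intro powr_mono2 diameter_affine_image_le q_pos) (auto simp: f_eq diameter_ge_0)
  also have "\<dots> = q i powr s * diameter B powr s"
    using q_pos[of i] assms by (simp add: powr_mult diameter_ge_0)
  finally show ?thesis
    using assms by (simp add: hd_term_pos ennreal_mult[symmetric] ennreal_leI)
qed

text \<open>Each \<open>f i\<close> scales the cost by at most \<open>q i powr s\<close>, so the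
  double series over first digit and remainder is bounded by a product, and every rank contributes
  one more factor \<open>c\<close>.\<close>

lemma sum_hd_term_cover:
  assumes "s > 0" "0 \<le> c"
    and fin: "\<And>F. finite F \<Longrightarrow> F \<subseteq> V \<Longrightarrow> (\<Sum>i\<in>F. q i powr s) \<le> c"
  shows "(\<Sum>m. hd_term s (cover n m)) \<le> ennreal (c ^ n)"
proof (induction n)
  case 0
  have "(\<Sum>m. hd_term s (cover 0 m)) = (\<Sum>m\<in>{0}. hd_term s (cover 0 m))"
    using \<open>s > 0\<close> by (intro suminf_finite) (auto simp: hd_term_def)
  then show ?case using \<open>s > 0\<close> by (simp add: hd_term_pos)
next
  case (Suc n)
  define T where "T = (\<lambda>i. if i \<in> V then ennreal (q i powr s) else 0)"
  have T: "(\<Sum>i. T i) \<le> ennreal c"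
  proof (rule suminf_le_const)
    fix n
    have "(\<Sum>i<n. T i) = (\<Sum>i\<in>{..<n} \<inter> V. ennreal (q i powr s))"
      unfolding T_def by (rule sum.inter_restrict[symmetric]) simp
    also have "\<dots> = ennreal (\<Sum>i\<in>{..<n} \<inter> V. q i powr s)" by (intro sum_ennreal) auto
    also have "\<dots> \<le> ennreal c" by (intro ennreal_leI fin) auto
    finally show "(\<Sum>i<n. T i) \<le> ennreal c" .
  qed simp
  define G where "G = (\<lambda>(i, j). hd_term s (if i \<in> V then f i ` cover n j else {}))"
  have "(\<Sum>m. hd_term s (cover (Suc n) m)) = (\<Sum>m. G (prod_decode m))"
    by (intro suminf_cong) (simp add: G_def split: prod.split)
  \<comment> \<open>\<open>prod_decode\<close> enumerates all pairs, and in \<open>ennreal\<close>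
    the rearrangement into a double series is unconditional.\<close>
  also have "\<dots> = (\<Sum>i. \<Sum>j. G (i, j))" by (intro suminf_ennreal_2dimen) simp
  also have "\<dots> \<le> (\<Sum>i. \<Sum>j. T i * hd_term s (cover n j))"
    by (intro suminf_le summableI)
       (simp add: G_def T_def hd_term_f_image[OF bounded_cover \<open>s > 0\<close>] hd_term_def[of s "{}"])
  also have "\<dots> = (\<Sum>i. T i) * (\<Sum>j. hd_term s (cover n j))" by simp
  also have "\<dots> \<le> ennreal c * ennreal (c ^ n)" by (intro mult_mono T Suc) auto
  finally show ?case using \<open>0 \<le> c\<close> by (simp add: ennreal_mult)
qed

text \<open>At rank \<open>n\<close> the cover has mesh at most \<open>r ^ n\<close> and cost at
  most \<open>c ^ n\<close>, and all leftovers together are countable.\<close>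

lemma hausdorff_measure_closed_limit_set_0:
  assumes "s > 0" "c < 1" "countable (gls_infty a q)"
    and fin: "\<And>F. finite F \<Longrightarrow> F \<subseteq> V \<Longrightarrow> (\<Sum>i\<in>F. q i powr s) \<le> c"
  shows "hausdorff_measure s (closed_limit_set V) = 0"
proof (rule hausdorff_measure_eq_0I[OF \<open>s > 0\<close>])
  have "0 \<le> c" using fin[of "{}"] by simp
  show "countable (\<Union>n. leftover n)" using countable_leftover assms(3) by blast
  show "closed_limit_set V \<subseteq> (\<Union>n. leftover n) \<union> (\<Union>m. cover n m)" for n
    using cover_covers[of n] by blast
  show "(\<lambda>n. r ^ n) \<longlonglongrightarrow> 0" using r_pos r_less_1 by (intro LIMSEQ_power_zero) auto
  have "(\<lambda>n. c ^ n) \<longlonglongrightarrow> 0" using \<open>0 \<le> c\<close> \<open>c < 1\<close> by (intro LIMSEQ_power_zero) auto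
  then show "(\<lambda>n. ennreal (c ^ n)) \<longlonglongrightarrow> 0" using tendsto_ennrealI ennreal_0 by metis
  show "(\<Sum>m. hd_term s (cover n m)) \<le> ennreal (c ^ n)" for n
    by (rule sum_hd_term_cover[OF \<open>s > 0\<close> \<open>0 \<le> c\<close> fin])
qed (auto intro: bounded_cover diameter_cover)

end

subsection \<open>Separated systems of cylinders\<close>

text \<open>The order is decided at the first differing digit; a common first digit only applies an
  increasing map to both sides.\<close>

lemma cylinders_ordered:
  assumes "length v = length w" "v \<noteq> w"
  shows "g v 0 + weight v \<le> g w 0 \<or> g w 0 + weight w \<le> g v 0"
  using assms
proof (induction v w rule: list_induct2)
  case (Cons i v j w)
  show ?case
  proof (cases "i = j")
    case True
    then have "g v 0 + weight v \<le> g w 0 \<or> g w 0 + weight w \<le> g v 0" using Cons by auto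
    then have "q i * (g v 0 + weight v) \<le> q i * g w 0 \<or> q i * (g w 0 + weight w) \<le> q i * g v 0"
      using q_pos[of i] by auto
    then show ?thesis using True by (auto simp: gls_f_def algebra_simps)
  next
    case False
    then have "a i + q i \<le> a j \<or> a j + q j \<le> a i" by (rule rank1_cylinders_ordered)
    \<comment> \<open>A cylinder lies inside the rank-1 cylinder of its first digit and inherits its
      position.\<close>
    moreover have "a k \<le> g (k # u) 0" "g (k # u) 0 + weight (k # u) \<le> a k + q k" for k u
    proof -
      have "g u 0 + weight u \<le> 1" "0 \<le> g u 0"
        using map_in_01[of 1 u] map_in_01[of 0 u] map_affine[of u 1] by auto
      then have "q k * (g u 0 + weight u) \<le> q k * 1" "0 \<le> q k * g u 0"
        using q_pos[of k] by (auto intro!: mult_left_mono)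
      then show "a k \<le> g (k # u) 0" "g (k # u) 0 + weight (k # u) \<le> a k + q k"
        by (auto simp: gls_f_def algebra_simps)
    qed
    ultimately show ?thesis by (meson order_trans)
  qed
qed simp

lemma sum_weight_powr:
  assumes "finite F"
  shows "(\<Sum>w\<in>{w. set w \<subseteq> F \<and> length w = n}. weight w powr s) = (\<Sum>i\<in>F. q i powr s) ^ n"
proof (induction n)
  case 0
  have "{w. set w \<subseteq> F \<and> length w = 0} = {[]}" by auto
  then show ?case by simp
next
  case (Suc n)
  let ?W = "{w. set w \<subseteq> F \<and> length w = n}"
  have "(\<Sum>w\<in>{w. set w \<subseteq> F \<and> length w = Suc n}. weight w powr s) =
        (\<Sum>(w, i)\<in>?W \<times> F. weight (i # w) powr s)"
    unfolding lists_length_Suc_eq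
    by (subst sum.reindex) (auto simp: inj_on_def intro!: sum.cong)
  also have "\<dots> = (\<Sum>w\<in>?W. \<Sum>i\<in>F. weight w powr s * q i powr s)"
    unfolding sum.cartesian_product
    by (intro sum.cong refl)
       (auto simp: powr_mult less_imp_le[OF q_pos] less_imp_le[OF weight_pos] mult.commute)
  also have "\<dots> = (\<Sum>w\<in>?W. weight w powr s) * (\<Sum>i\<in>F. q i powr s)"
    by (simp add: sum_product)
  finally show ?case using Suc by simp
qed

text \<open>Words over the finite \<open>F\<close> give finitely many contractions that map the
  whole compact set \<open>closed_limit_set V\<close> into itself, so the finite covering bound
  applies even when \<open>V\<close> is infinite.\<close>

lemma hausdorff_measure_closed_limit_set_nonzero:
  assumes "s \<ge> 0" "finite F" "F \<subseteq> V" and gt: "(\<Sum>i\<in>F. q i powr s) > 1"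
  shows "hausdorff_measure s (closed_limit_set V) \<noteq> 0"
proof -
  have "V \<noteq> {}" using assms by auto
  note ne = closed_limit_set_nonempty[OF this]
  show ?thesis
  proof (cases "s = 0")
    case True
    then show ?thesis using hausdorff_measure_nonzero_0[OF ne] by simp
  next
    case False
    then have "s > 0" using assms by simp
    \<comment> \<open>The bound 2 allows for the halving in
      \<open>separated_subfamily\<close>.\<close>
    obtain n where "(\<Sum>i\<in>F. q i powr s) ^ n > 2" using real_arch_pow[OF gt] by blast
    then have "n > 0" by (cases n) auto
    define W where "W = {w. set w \<subseteq> F \<and> length w = n}"
    have "finite W" unfolding W_def using \<open>finite F\<close> by (rule finite_lists_length_eq)
    have W2: "(\<Sum>w\<in>W. weight w powr s) \<ge> 2"
      unfolding W_def sum_weight_powr[OF \<open>finite F\<close>] using \<open>_ > 2\<close> by simp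
    then have "W \<noteq> {}" by auto
    \<comment> \<open>The shortest cylinder length: a cylinder left out between two chosen ones
      makes a gap of at least this size.\<close>
    define \<epsilon> where "\<epsilon> = Min (weight ` W)"
    have "\<epsilon> > 0" unfolding \<epsilon>_def using \<open>finite W\<close> \<open>W \<noteq> {}\<close> weight_pos by (subst Min_gr_iff) auto
    have le: "weight w \<ge> \<epsilon>" if "w \<in> W" for w
      using that \<open>finite W\<close> by (simp add: \<epsilon>_def)
    obtain J where J: "J \<subseteq> W" "(\<Sum>w\<in>J. weight w powr s) \<ge> 1"
      and gap: "\<And>v w. v \<in> J \<Longrightarrow> w \<in> J \<Longrightarrow> v \<noteq> w \<Longrightarrow>
        g v 0 + weight v + \<epsilon> \<le> g w 0 \<or> g w 0 + weight w + \<epsilon> \<le> g v 0"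
    proof (rule separated_subfamily[OF \<open>finite W\<close> le \<open>\<epsilon> > 0\<close> _ W2, where c = "\<lambda>w. g w 0"])
      fix v w assume "v \<in> W" "w \<in> W" "v \<noteq> w"
      then show "g v 0 + weight v \<le> g w 0 \<or> g w 0 + weight w \<le> g v 0"
        by (intro cylinders_ordered) (auto simp: W_def)
    qed (use that in blast)+
    have "finite J" using J(1) \<open>finite W\<close> finite_subset by blast
    \<comment> \<open>A single word has weight below 1, because \<open>n > 0\<close>, and could not
      reach the sum 1.\<close>
    have "card J \<ge> 2"
    proof (rule ccontr)
      assume "\<not> card J \<ge> 2"
      then have "card J = 0 \<or> card J = 1" by linarith
      moreover have "J \<noteq> {}" using J(2) by auto
      ultimately obtain w where w: "J = {w}"
        using \<open>finite J\<close> card_1_singletonE[of J] by auto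
      have "weight w \<le> r ^ n" using weight_le[of w] w J(1) by (auto simp: W_def)
      also have "\<dots> < 1" using r_pos r_less_1 \<open>n > 0\<close> by (simp add: power_less_one_iff)
      finally have "weight w powr s < 1 powr s"
        using \<open>s > 0\<close> less_imp_le[OF weight_pos[of w]] by (intro powr_less_mono2) auto
      then show False using J(2) w by simp
    qed
    show ?thesis
    proof (rule hausdorff_measure_nonzero_compact[OF compact_closed_limit_set \<open>s > 0\<close>])
      show "\<epsilon> powr s > 0" using \<open>\<epsilon> > 0\<close> by simp
      fix I :: "nat set" and U :: "nat \<Rightarrow> real set" and l :: "nat \<Rightarrow> real"
      assume cov: "finite I" "closed_limit_set V \<subseteq> (\<Union>i\<in>I. U i)"
        "\<And>i x y. i \<in> I \<Longrightarrow> x \<in> U i \<Longrightarrow> y \<in> U i \<Longrightarrow> \<bar>x - y\<bar> \<le> l i" "\<And>i. i \<in> I \<Longrightarrow> l i \<ge> 0"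
      show "\<epsilon> powr s \<le> (\<Sum>i\<in>I. l i powr s)"
      proof (rule separated_cover_sum_ge[OF ne \<open>finite J\<close> \<open>card J \<ge> 2\<close> weight_pos _ _ J(2) \<open>\<epsilon> > 0\<close> \<open>s > 0\<close> cov,
            where c = "\<lambda>w. g w 0"])
        fix w x assume "w \<in> J" "x \<in> closed_limit_set V"
        then have "w \<in> W" using J(1) by blast
        then have "set w \<subseteq> V" using \<open>F \<subseteq> V\<close> unfolding W_def by blast
        then have "g w x \<in> closed_limit_set V"
          using \<open>x \<in> _\<close> by (rule map_closed_limit_set)
        then show "g w 0 + weight w * x \<in> closed_limit_set V" by (simp add: map_affine[of w x])
      next
        fix v w x y assume "v \<in> J" "w \<in> J" "v \<noteq> w" "x \<in> closed_limit_set V" "y \<in> closed_limit_set V"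
        moreover from this have "x \<in> {0..1}" "y \<in> {0..1}" using closed_limit_set_subset by blast+
        then have "0 \<le> weight v * x" "weight v * x \<le> weight v" "0 \<le> weight w * y" "weight w * y \<le> weight w"
          using weight_pos[of v] weight_pos[of w] by (auto intro: mult_left_le)
        ultimately show "\<epsilon> \<le> \<bar>g v 0 + weight v * x - (g w 0 + weight w * y)\<bar>"
          using gap[of v w] by linarith
      qed
    qed
  qed
qed

text \<open>A critical exponent criterion, phrased with finite subsums so that a divergent sum over
  \<open>V\<close> is covered too.\<close>

lemma hausdorff_dim_closed_limit_set:
  assumes "countable (gls_infty a q)" "D \<ge> 0"
    and upper: "\<And>s. s > D \<Longrightarrow> \<exists>c<1. \<forall>F. finite F \<longrightarrow> F \<subseteq> V \<longrightarrow> (\<Sum>i\<in>F. q i powr s) \<le> c"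
    and lower: "\<And>s. 0 \<le> s \<Longrightarrow> s < D \<Longrightarrow> \<exists>F. finite F \<and> F \<subseteq> V \<and> (\<Sum>i\<in>F. q i powr s) > 1"
  shows "hausdorff_dim (closed_limit_set V) = D"
proof -
  let ?Z = "{s. s \<ge> 0 \<and> hausdorff_measure s (closed_limit_set V) = 0}"
  have up: "s \<in> ?Z" if "s > D" for s
  proof -
    obtain c where "c < 1" "\<forall>F. finite F \<longrightarrow> F \<subseteq> V \<longrightarrow> (\<Sum>i\<in>F. q i powr s) \<le> c"
      using upper[OF \<open>s > D\<close>] by blast
    then have "hausdorff_measure s (closed_limit_set V) = 0"
      using that \<open>D \<ge> 0\<close> assms(1) by (intro hausdorff_measure_closed_limit_set_0) auto
    then show ?thesis using that \<open>D \<ge> 0\<close> by simp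
  qed
  have low: "D \<le> s" if s: "s \<in> ?Z" for s
  proof (rule ccontr)
    assume "\<not> D \<le> s"
    then obtain F where "finite F" "F \<subseteq> V" "(\<Sum>i\<in>F. q i powr s) > 1"
      using lower[of s] s by auto
    then have "hausdorff_measure s (closed_limit_set V) \<noteq> 0"
      using s by (intro hausdorff_measure_closed_limit_set_nonzero) auto
    then show False using s by simp
  qed
  have "bdd_below ?Z" by (auto intro!: bdd_belowI[of _ 0])
  then have "Inf ?Z \<le> s" if "s > D" for s using up[OF that] by (rule cInf_lower[rotated])
  then have "Inf ?Z \<le> D" by (rule dense_ge)
  \<comment> \<open>\<open>D + 1\<close> shows that the set is nonempty; \<open>D\<close> itself
    need not belong to it.\<close>
  moreover have "D \<le> Inf ?Z" using up[of "D + 1"] low by (intro cInf_greatest) auto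
  ultimately show ?thesis by (simp add: hausdorff_dim_def)
qed

end

subsection \<open>The spectrum as a closed limit set\<close>

text \<open>A closed set missing a point of the limit set misses a whole cylinder around it, which
  has positive probability, so closed sets of probability 1 contain the limit set. Conversely all
  digits are almost surely in \<open>V\<close>, so the closed limit set is one of the sets
  intersected.\<close>

lemma (in gls) spectrum_eq_closed_limit_set:
  fixes M :: "'m measure" and X :: "nat \<Rightarrow> 'm \<Rightarrow> nat" and p :: "nat \<Rightarrow> real"
  assumes P: "prob_space M"
    and p_nonneg: "\<And>i. p i \<ge> 0"
    and indep: "prob_space.indep_vars M (\<lambda>_. count_space UNIV) X {1..}"
    and distr: "\<And>k i. k \<ge> 1 \<Longrightarrow> measure M {\<omega> \<in> space M. X k \<omega> = i} = p i"
  shows "spectrum_of M (\<lambda>\<omega>. gls_point a q (\<lambda>k. X (Suc k) \<omega>)) = closed_limit_set {i. p i > 0}"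
proof -
  interpret prob_space M by (rule P)
  define \<xi> where "\<xi> = (\<lambda>\<omega>. gls_point a q (\<lambda>k. X (Suc k) \<omega>))"
  define V where "V = {i. p i > 0}"
  have X_meas [measurable]: "X (Suc k) \<in> measurable M (count_space UNIV)" for k
  proof -
    have "\<forall>i\<in>{1..}. X i \<in> measurable M (count_space UNIV)"
      using indep unfolding indep_vars_def by (rule conjunct1)
    then show ?thesis by (rule bspec) simp
  qed
  \<comment> \<open>There are countably many words, so the preimages of single words are
    enough.\<close>
  have word_meas: "(\<lambda>\<omega>. prefix_word (\<lambda>k. X (Suc k) \<omega>) n) \<in> measurable M (count_space UNIV)" for n
  proof -
    have "(\<lambda>\<omega>. prefix_word (\<lambda>k. X (Suc k) \<omega>) n) -` {w} \<inter> space M \<in> sets M" for w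
    proof -
      have eq: "prefix_word d n = w \<longleftrightarrow> length w = n \<and> (\<forall>k<n. d k = w ! k)" for d
        unfolding list_eq_iff_nth_eq by (simp cong: conj_cong) blast
      have "(\<lambda>\<omega>. prefix_word (\<lambda>k. X (Suc k) \<omega>) n) -` {w} \<inter> space M =
            {\<omega> \<in> space M. length w = n \<and> (\<forall>k<n. X (Suc k) \<omega> = w ! k)}"
        by (intro set_eqI) (simp only: Int_iff vimage_eq singleton_iff mem_Collect_eq eq conj_commute)
      also have "\<dots> \<in> sets M" by measurable
      finally show ?thesis .
    qed
    then show ?thesis
      by (intro measurable_count_space_eq2_countable[THEN iffD2]) simp_all
  qed
  have \<xi>_meas [measurable]: "\<xi> \<in> borel_measurable M"
  proof (rule borel_measurable_LIMSEQ_real)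
    show "(\<lambda>n. g (prefix_word (\<lambda>k. X (Suc k) \<omega>) n) 0) \<longlonglongrightarrow> \<xi> \<omega>" for \<omega>
      unfolding \<xi>_def by (rule point_LIMSEQ)
    show "(\<lambda>\<omega>. g (prefix_word (\<lambda>k. X (Suc k) \<omega>) n) 0) \<in> borel_measurable M" for n
      by (rule measurable_compose[OF word_meas]) simp
  qed
  have "limit_set V \<subseteq> S"
    if "closed S" "{\<omega> \<in> space M. \<xi> \<omega> \<in> S} \<in> sets M" "prob {\<omega> \<in> space M. \<xi> \<omega> \<in> S} = 1" for S
  proof
    fix x assume "x \<in> limit_set V"
    then obtain d where d: "\<And>k. d k \<in> V" "x = gls_point a q d" by (auto simp: limit_set_def)
    show "x \<in> S"
    proof (rule ccontr)
      assume "x \<notin> S"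
      then obtain e where e: "e > 0" "ball x e \<subseteq> - S"
        using \<open>closed S\<close> by (meson ComplI open_Compl open_contains_ball)
      obtain n where n: "r ^ n < e" using real_arch_pow_inv[OF \<open>e > 0\<close> r_less_1] by blast
      \<comment> \<open>\<open>X\<close> is numbered from 1 and \<open>d\<close> from 0. Taking
        \<open>Suc n\<close> digits keeps the index set nonempty even for
        \<open>n = 0\<close>.\<close>
      define E where "E = (\<Inter>i\<in>{1..Suc n}. X i -` {d (i - 1)} \<inter> space M)"
      have "prob E = (\<Prod>i\<in>{1..Suc n}. prob (X i -` {d (i - 1)} \<inter> space M))"
        unfolding E_def by (rule indep_varsD[OF indep]) auto
      also have "\<dots> = (\<Prod>i\<in>{1..Suc n}. p (d (i - 1)))"
      proof (intro prod.cong refl)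
        fix i assume "i \<in> {1..Suc n}"
        then show "prob (X i -` {d (i - 1)} \<inter> space M) = p (d (i - 1))"
          using distr[of i "d (i - 1)"] by (simp add: vimage_def Int_def conj_commute)
      qed
      also have "\<dots> > 0" using d(1) by (intro prod_pos) (auto simp: V_def)
      finally have "prob E > 0" .
      have X_i: "X i \<in> measurable M (count_space UNIV)" if "i \<ge> 1" for i
        using X_meas[of "i - 1"] that by simp
      have "E \<in> events"
        unfolding E_def using X_i by (intro sets.finite_INT) (auto intro!: measurable_sets)
      have "\<xi> \<omega> \<notin> S" if "\<omega> \<in> E" for \<omega>
      proof -
        have "X (Suc k) \<omega> = d k" if "k < n" for k
          using \<open>\<omega> \<in> E\<close> that unfolding E_def by (auto dest!: bspec[of _ _ "Suc k"])
        then have "prefix_word (\<lambda>k. X (Suc k) \<omega>) n = prefix_word d n" by auto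
        then have "\<xi> \<omega> \<in> gls_cyl a q (prefix_word d n)"
          using point_in_cyl[of "\<lambda>k. X (Suc k) \<omega>" n] by (simp only: \<xi>_def)
        then have "\<bar>x - \<xi> \<omega>\<bar> \<le> r ^ n"
          using cyl_dist_le[OF point_in_cyl[of d n]] d(2) by fastforce
        then show ?thesis using e(2) n by (auto simp: dist_real_def subset_iff)
      qed
      then have "E \<inter> {\<omega> \<in> space M. \<xi> \<omega> \<in> S} = {}" by blast
      \<comment> \<open>Disjoint from an event of probability 1, \<open>E\<close> would push the
        total above 1.\<close>
      then have "prob (E \<union> {\<omega> \<in> space M. \<xi> \<omega> \<in> S}) = prob E + 1"
        using \<open>E \<in> events\<close> that by (simp add: finite_measure_Union)
      then show False using \<open>prob E > 0\<close> prob_le_1[of "E \<union> {\<omega> \<in> space M. \<xi> \<omega> \<in> S}"] by linarith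
    qed
  qed
  then have "closed_limit_set V \<subseteq> spectrum_of M \<xi>"
    unfolding spectrum_of_def by (intro Inter_greatest closure_minimal) auto
  moreover have "spectrum_of M \<xi> \<subseteq> closed_limit_set V"
  proof -
    have "\<xi> -` closed_limit_set V \<inter> space M \<in> events"
      by (intro measurable_sets[OF \<xi>_meas] borel_closed) simp
    then have ev: "{\<omega> \<in> space M. \<xi> \<omega> \<in> closed_limit_set V} \<in> events"
      by (simp add: vimage_def Int_def conj_commute)
    \<comment> \<open>There are countably many null events here, one for each position and each
      digit of probability 0.\<close>
    have "AE \<omega> in M. \<forall>k. \<forall>i. p i = 0 \<longrightarrow> X (Suc k) \<omega> \<noteq> i"
      unfolding AE_all_countable
    proof (intro allI)
      fix k i
      have "{\<omega> \<in> space M. X (Suc k) \<omega> = i} \<in> events" by measurable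
      then have "AE \<omega> in M. \<omega> \<notin> {\<omega> \<in> space M. X (Suc k) \<omega> = i}" if "p i = 0"
        using prob_eq_0 distr[of "Suc k" i] that by simp
      then show "AE \<omega> in M. p i = 0 \<longrightarrow> X (Suc k) \<omega> \<noteq> i"
        by (cases "p i = 0") auto
    qed
    then have "AE \<omega> in M. \<omega> \<in> {\<omega> \<in> space M. \<xi> \<omega> \<in> closed_limit_set V}"
    proof (rule AE_mp, intro AE_I2 impI)
      fix \<omega> assume \<omega>: "\<omega> \<in> space M" "\<forall>k. \<forall>i. p i = 0 \<longrightarrow> X (Suc k) \<omega> \<noteq> i"
      then have "X (Suc k) \<omega> \<in> V" for k
        using p_nonneg[of "X (Suc k) \<omega>"] by (auto simp: V_def less_le)
      then have "\<xi> \<omega> \<in> limit_set V" by (auto simp: \<xi>_def limit_set_def)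
      then show "\<omega> \<in> {\<omega> \<in> space M. \<xi> \<omega> \<in> closed_limit_set V}"
        using closure_subset \<omega>(1) by blast
    qed
    then have "prob {\<omega> \<in> space M. \<xi> \<omega> \<in> closed_limit_set V} = 1"
      using prob_eq_1[OF ev] by simp
    then show ?thesis unfolding spectrum_of_def using ev by (intro Inter_lower) simp
  qed
  ultimately show ?thesis by (simp add: \<xi>_def V_def)
qed

subsection \<open>Roots of the dimension equation\<close>

context gls
begin

lemma sum_powr_le:
  "s \<le> t \<Longrightarrow> (\<Sum>i\<in>F. q i powr t) \<le> r powr (t - s) * (\<Sum>i\<in>F. q i powr s)"
  unfolding sum_distrib_left by (intro sum_mono powr_le_powr_diff_mult q_pos q_le_r)

lemma r_powr_less_1: "e > 0 \<Longrightarrow> r powr e < 1"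
  using powr_less_mono2[of e r 1] r_pos r_less_1 by simp

text \<open>With \<open>F = G\<close> this gives uniqueness of the root, otherwise growth of the
  roots with the set. If \<open>y < x\<close>, the sum over \<open>F\<close> at \<open>x\<close> is
  at most \<open>r powr (x - y) < 1\<close> times the sum over \<open>G\<close> at
  \<open>y\<close>.\<close>

lemma root_mono:
  assumes "finite G" "F \<subseteq> G" "(\<Sum>i\<in>F. q i powr x) = 1" "(\<Sum>i\<in>G. q i powr y) = 1"
  shows "x \<le> y"
proof (rule ccontr)
  assume "\<not> x \<le> y"
  then have "1 \<le> r powr (x - y) * (\<Sum>i\<in>F. q i powr y)"
    using sum_powr_le[of y x F] assms(3) by simp
  also have "\<dots> \<le> r powr (x - y) * (\<Sum>i\<in>G. q i powr y)"
    using assms by (intro mult_left_mono sum_mono2) auto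
  also have "\<dots> < 1" using assms(4) r_powr_less_1[of "x - y"] \<open>\<not> x \<le> y\<close> by simp
  finally show False by simp
qed

text \<open>Intermediate values: the sum is \<open>card F \<ge> 1\<close> at exponent 0 and at most
  1 at exponent 1.\<close>

lemma root_exists:
  assumes "finite F" "F \<noteq> {}"
  shows "\<exists>x\<in>{0..1}. (\<Sum>i\<in>F. q i powr x) = 1"
proof -
  have "\<exists>x\<ge>0. x \<le> 1 \<and> (\<Sum>i\<in>F. q i powr x) = 1"
  proof (rule IVT2')
    show "(\<Sum>i\<in>F. q i powr 1) \<le> 1"
      using sum_q_le_1[OF \<open>finite F\<close>] q_pos by (simp add: less_imp_le)
    have "(\<Sum>i\<in>F. q i powr 0) = card F" using q_pos by (simp add: less_imp_neq[symmetric])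
    then show "1 \<le> (\<Sum>i\<in>F. q i powr 0)" using assms by (simp add: Suc_le_eq card_gt_0_iff)
    show "continuous_on {0..1} (\<lambda>x. \<Sum>i\<in>F. q i powr x)"
      using q_pos by (intro continuous_intros) (auto simp: less_imp_neq[symmetric])
  qed simp
  then show ?thesis by auto
qed

text \<open>Finite subsums at \<open>\<alpha>\<close> are at most 1 and come arbitrarily close to
  it. Moving the exponent either way changes them by at least a uniform factor, which decides the
  side of 1.\<close>

lemma hausdorff_dim_root:
  assumes "countable (gls_infty a q)" "\<alpha> \<ge> 0" and hs: "((\<lambda>i. q i powr \<alpha>) has_sum 1) V"
  shows "hausdorff_dim (closed_limit_set V) = \<alpha>"
proof (rule hausdorff_dim_closed_limit_set[OF assms(1,2)])
  fix s assume "s > \<alpha>"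
  have "(\<Sum>i\<in>F. q i powr s) \<le> r powr (s - \<alpha>)" if "finite F" "F \<subseteq> V" for F
  proof -
    have "(\<Sum>i\<in>F. q i powr \<alpha>) \<le> 1" using that by (intro finite_sum_le_has_sum[OF hs]) auto
    then have "r powr (s - \<alpha>) * (\<Sum>i\<in>F. q i powr \<alpha>) \<le> r powr (s - \<alpha>) * 1"
      by (rule mult_left_mono) simp
    then show ?thesis using sum_powr_le[of \<alpha> s F] \<open>s > \<alpha>\<close> by simp
  qed
  then show "\<exists>c<1. \<forall>F. finite F \<longrightarrow> F \<subseteq> V \<longrightarrow> (\<Sum>i\<in>F. q i powr s) \<le> c"
    using r_powr_less_1[of "s - \<alpha>"] \<open>s > \<alpha>\<close> by auto
next
  fix s :: real assume "0 \<le> s" "s < \<alpha>"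
  have "((\<lambda>F. \<Sum>i\<in>F. q i powr \<alpha>) \<longlongrightarrow> 1) (finite_subsets_at_top V)"
    using hs by (simp add: has_sum_def)
  \<comment> \<open>The threshold is the factor regained when the exponent drops from
    \<open>\<alpha>\<close> to \<open>s\<close>.\<close>
  then have "\<forall>\<^sub>F F in finite_subsets_at_top V. (\<Sum>i\<in>F. q i powr \<alpha>) > r powr (\<alpha> - s)"
    using r_powr_less_1[of "\<alpha> - s"] \<open>s < \<alpha>\<close> by (intro order_tendstoD(1)) auto
  then obtain F where F: "finite F" "F \<subseteq> V" "(\<Sum>i\<in>F. q i powr \<alpha>) > r powr (\<alpha> - s)"
    by (auto simp: eventually_finite_subsets_at_top)
  have "r powr (\<alpha> - s) * 1 < r powr (\<alpha> - s) * (\<Sum>i\<in>F. q i powr s)"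
    using F(3) sum_powr_le[of s \<alpha> F] \<open>s < \<alpha>\<close> by simp
  then have "(\<Sum>i\<in>F. q i powr s) > 1" using r_pos by (simp add: mult_less_cancel_left)
  then show "\<exists>F. finite F \<and> F \<subseteq> V \<and> (\<Sum>i\<in>F. q i powr s) > 1" using F by blast
qed

text \<open>The roots increase and are bounded by 1, so they converge. The limit meets the critical
  exponent criterion because every finite subset of \<open>V\<close> lies in an initial segment of
  its enumeration.\<close>

lemma roots_tendsto_hausdorff_dim:
  assumes "countable (gls_infty a q)" "infinite V"
  shows "(\<lambda>k. THE x. (\<Sum>i \<in> enumerate V ` {..<Suc k}. q i powr x) = 1)
           \<longlonglongrightarrow> hausdorff_dim (closed_limit_set V)"
proof -
  \<comment> \<open>\<open>Suc k\<close> elements are taken, since the empty sum has no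
    root.\<close>
  define W where "W = (\<lambda>k. enumerate V ` {..<Suc k})"
  define \<alpha> where "\<alpha> = (\<lambda>k. THE x. (\<Sum>i\<in>W k. q i powr x) = 1)"
  have W: "finite (W k)" "W k \<noteq> {}" "W k \<subseteq> V" for k
    using \<open>infinite V\<close> by (auto simp: W_def enumerate_in_set)
  have \<alpha>: "\<alpha> k \<in> {0..1} \<and> (\<Sum>i\<in>W k. q i powr \<alpha> k) = 1" for k
  proof -
    obtain x where x: "x \<in> {0..1}" "(\<Sum>i\<in>W k. q i powr x) = 1" using root_exists[OF W(1,2)] by blast
    have "\<alpha> k = x" unfolding \<alpha>_def
      using x(2) root_mono[OF W(1) order_refl] by (intro the_equality) (auto intro: antisym)
    then show ?thesis using x by simp
  qed
  have "incseq \<alpha>"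
  proof (rule incseq_SucI)
    fix k show "\<alpha> k \<le> \<alpha> (Suc k)"
      by (rule root_mono[OF W(1)[of "Suc k"], of "W k"]) (use \<alpha> in \<open>auto simp: W_def\<close>)
  qed
  moreover have "\<forall>k. \<alpha> k \<le> 1" using \<alpha> by simp
  ultimately obtain L where L: "\<alpha> \<longlonglongrightarrow> L" "\<forall>k. \<alpha> k \<le> L" by (rule incseq_convergent)
  have "0 \<le> L" using L(2) \<alpha>[of 0] by (auto intro: order_trans)
  have "hausdorff_dim (closed_limit_set V) = L"
  proof (rule hausdorff_dim_closed_limit_set[OF assms(1) \<open>0 \<le> L\<close>])
    fix s assume "s > L"
    have "(\<Sum>i\<in>F. q i powr s) \<le> r powr (s - L)" if "finite F" "F \<subseteq> V" for F
    proof -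
      have "F \<subseteq> enumerate V ` UNIV" using that range_enumerate[OF \<open>infinite V\<close>] by simp
      then obtain C where C: "finite C" "F = enumerate V ` C"
        using finite_subset_image[OF \<open>finite F\<close>] by metis
      then obtain k where "\<forall>n\<in>C. n < k" by (auto simp: finite_nat_set_iff_bounded)
      then have "F \<subseteq> W k" using C by (auto simp: W_def)
      then have "(\<Sum>i\<in>F. q i powr s) \<le> (\<Sum>i\<in>W k. q i powr s)"
        using W(1) by (intro sum_mono2) auto
      also have "\<dots> \<le> r powr (s - \<alpha> k)"
        using sum_powr_le[of "\<alpha> k" s "W k"] \<alpha>[of k] L(2)[rule_format, of k] \<open>s > L\<close> by simp
      \<comment> \<open>The final bound must not depend on \<open>F\<close>, hence not on
        \<open>k\<close>; \<open>\<alpha> k \<le> L\<close> and \<open>r < 1\<close> remove that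
        dependence.\<close>
      also have "\<dots> \<le> r powr (s - L)"
        using r_pos r_less_1 L(2) by (intro powr_mono') auto
      finally show ?thesis .
    qed
    then show "\<exists>c<1. \<forall>F. finite F \<longrightarrow> F \<subseteq> V \<longrightarrow> (\<Sum>i\<in>F. q i powr s) \<le> c"
      using r_powr_less_1[of "s - L"] \<open>s > L\<close> by auto
  next
    fix s :: real assume "0 \<le> s" "s < L"
    then have "\<forall>\<^sub>F k in sequentially. s < \<alpha> k" using L(1) by (intro order_tendstoD(1))
    then obtain k where k: "s < \<alpha> k" by (auto simp: eventually_sequentially)
    have "1 \<le> r powr (\<alpha> k - s) * (\<Sum>i\<in>W k. q i powr s)"
      using sum_powr_le[of s "\<alpha> k" "W k"] \<alpha>[of k] k by simp
    moreover have "r powr (\<alpha> k - s) * (\<Sum>i\<in>W k. q i powr s) < 1 * (\<Sum>i\<in>W k. q i powr s)"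
      using r_powr_less_1[of "\<alpha> k - s"] k W q_pos
      by (intro mult_strict_right_mono sum_pos) (auto simp: less_imp_neq[symmetric])
    ultimately show "\<exists>F. finite F \<and> F \<subseteq> V \<and> (\<Sum>i\<in>F. q i powr s) > 1"
      using W by (intro exI[of _ "W k"]) auto
  qed
  then show ?thesis using L(1) by (simp add: \<alpha>_def W_def)
qed

end

theorem theorem4:
  fixes a q p :: "nat \<Rightarrow> real" and M :: "'m measure" and X :: "nat \<Rightarrow> 'm \<Rightarrow> nat"
  assumes gls: "gls_expansion a q"
    and P: "prob_space M"
    and p_nonneg: "\<forall>i. p i \<ge> 0" and p_sum: "p sums 1"
    and indep: "prob_space.indep_vars M (\<lambda>_. count_space UNIV) X {1..}"
    and distr: "\<forall>k\<ge>1. \<forall>i. measure M {\<omega> \<in> space M. X k \<omega> = i} = p i"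
    and cnt: "countable (gls_infty a q)"
  defines "\<xi> \<equiv> (\<lambda>\<omega>. gls_point a q (\<lambda>k. X (Suc k) \<omega>))"
    and "V \<equiv> {i. p i > 0}"
  shows
    "(\<forall>\<alpha>0. \<alpha>0 \<in> {0..1} \<and> ((\<lambda>i. q i powr \<alpha>0) has_sum 1) V \<and>
             (\<forall>x\<in>{0..1}. ((\<lambda>i. q i powr x) has_sum 1) V \<longrightarrow> x = \<alpha>0)
           \<longrightarrow> hausdorff_dim (spectrum_of M \<xi>) = \<alpha>0)
     \<and> ((\<not> (\<exists>x\<in>{0..1}. ((\<lambda>i. q i powr x) has_sum 1) V)) \<longrightarrow>
         (\<lambda>k. THE x. (\<Sum>i \<in> enumerate V ` {..<Suc k}. q i powr x) = 1)
           \<longlonglongrightarrow> hausdorff_dim (spectrum_of M \<xi>))"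
proof -
  interpret gls a q by standard (rule gls)
  have spec: "spectrum_of M \<xi> = closed_limit_set V"
    unfolding \<xi>_def V_def
    by (rule spectrum_eq_closed_limit_set[OF P _ indep]) (use p_nonneg distr in auto)
  \<comment> \<open>For finite nonempty \<open>V\<close> the lemma \<open>root_exists\<close>
    supplies a root. So the second case has infinite \<open>V\<close>, where
    \<open>enumerate V\<close> lists exactly its elements.\<close>
  have "infinite V" if no_root: "\<not> (\<exists>x\<in>{0..1}. ((\<lambda>i. q i powr x) has_sum 1) V)"
  proof
    assume "finite V"
    have "V \<noteq> {}"
    proof
      assume "V = {}"
      then have "p = (\<lambda>_. 0)" using p_nonneg by (auto simp: V_def fun_eq_iff less_le)
      then show False using p_sum sums_unique2[OF sums_zero] by fastforce
    qed
    then obtain x where "x \<in> {0..1}" "(\<Sum>i\<in>V. q i powr x) = 1"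
      using root_exists[OF \<open>finite V\<close>] by blast
    then show False using no_root has_sum_finiteI[OF \<open>finite V\<close>] by metis
  qed
  then show ?thesis
    unfolding spec using cnt hausdorff_dim_root roots_tendsto_hausdorff_dim by auto
qed

end
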